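(* Let $E$ be a finite-dimensional real vector space, $Q\subset E$ nonempty, convex and compact, and $h:Q\to\mathbb{R}$ concave and differentiable on $Q$, with finite curvature constant $C_{h,Q}$. Let $\{\lambda_k\}_{k\ge1}$, $\{\tilde\lambda_k\}_{k\ge1}$, $\{B_k\}_{k\ge0}$ and $\{G_k\}_{k\ge 1}$ be the iterates, the upper bounds on $h^*=\max_{\lambda\in Q}h(\lambda)$ and the FW gaps generated by the Frank-Wolfe method with an arbitrary step-size sequence $\{\bar\alpha_k\}_{k\ge 1}\subset[0,1)$, and let $\{\alpha_k\},\{\beta_k\}$ be the associated dual averages sequences. Then for every $\ell\ge0$ and $k\ge\ell+1$ such that $\sum_{i=\ell+1}^k\bar\alpha_i>0$: $$\min_{i\in\{\ell+1,\ldots,k\}}G_i\le\frac{1}{\sum_{i=\ell+1}^k\bar\alpha_i}\left[\frac{B_\ell-h(\lambda_1)}{\beta_{\ell+1}}+\frac{\frac12C_{h,Q}\sum_{i=1}^\ell\frac{\alpha_i^2}{\beta_{i+1}}}{\beta_{\ell+1}}\right]+\frac{\frac12C_{h,Q}\sum_{i=\ell+1}^k\bar\alpha_i^2}{\sum_{i=\ell+1}^k\bar\alpha_i}.$$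
   Context: Notation: $E^*$ is the dual space of $E$ and $s^T\lambda$ is the evaluation of $s\in E^*$ at $\lambda\in E$; $\nabla h(\lambda)\in E^*$. Curvature constant: $C_{h,Q}$ is the minimal $C$ such that $h(\lambda+\alpha(\bar\lambda-\lambda))\ge h(\lambda)+\nabla h(\lambda)^T(\alpha(\bar\lambda-\lambda))-\frac12 C\alpha^2$ for all $\lambda,\bar\lambda\in Q$ and all $\alpha\in[0,1]$ (assumed finite). Frank-Wolfe method for maximizing $h$ over $Q$: start at $\lambda_1\in Q$ with an upper bound $B_0\ge h^*$ ($B_0=+\infty$ allowed if no bound is available, inequalities being then read in the extended reals). At iteration $k\ge1$: choose $\tilde\lambda_k\in\arg\max_{\lambda\in Q}\{h(\lambda_k)+\nabla h(\lambda_k)^T(\lambda-\lambda_k)\}$; set $B^w_k=h(\lambda_k)+\nabla h(\lambda_k)^T(\tilde\lambda_k-\lambda_k)$ and the FW gap $G_k=\nabla h(\lambda_k)^T(\tilde\lambda_k-\lambda_k)$; set $B_k=\min\{B_{k-1},B^w_k,B^o_k\}$, where $B^o_k\ge h^*$ is any other (optional) upper bound on $h^*$ (omitted, or $+\infty$, if not computed); set $\lambda_{k+1}=\lambda_k+\bar\alpha_k(\tilde\lambda_k-\lambda_k)$ with $\bar\alpha_k\in[0,1)$. Dual averages sequences: $\beta_k=\frac{1}{\prod_{j=1}^{k-1}(1-\bar\alpha_j)}$ and $\alpha_k=\frac{\beta_k\bar\alpha_k}{1-\bar\alpha_k}$ for $k\ge1$. Empty products equal $1$, empty sums equal $0$.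 *)

theory Defs
  imports "HOL-Analysis.Analysis"
begin

definition max_value :: "('a \<Rightarrow> real) \<Rightarrow> 'a set \<Rightarrow> real" where
  "max_value h Q = (GREATEST v. v \<in> h ` Q)"

definition curvature_bound ::
  "('a::real_normed_vector \<Rightarrow> real) \<Rightarrow> ('a \<Rightarrow> 'a \<Rightarrow>\<^sub>L real) \<Rightarrow> 'a set \<Rightarrow> real \<Rightarrow> bool" where
  "curvature_bound h grad Q C \<longleftrightarrow>
     (\<forall>x\<in>Q. \<forall>y\<in>Q. \<forall>\<alpha>\<in>{0..1}.
        h (x + \<alpha> *\<^sub>R (y - x)) \<ge>
          h x + blinfun_apply (grad x) (\<alpha> *\<^sub>R (y - x)) - 1 / 2 * C * \<alpha>\<^sup>2)"

definition finite_curvature ::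
  "('a::real_normed_vector \<Rightarrow> real) \<Rightarrow> ('a \<Rightarrow> 'a \<Rightarrow>\<^sub>L real) \<Rightarrow> 'a set \<Rightarrow> bool" where
  "finite_curvature h grad Q \<longleftrightarrow> (\<exists>C. curvature_bound h grad Q C)"

text \<open>For nonempty \<open>Q\<close> and finite curvature the admissible constants form a nonempty closed set of
  nonnegative reals (take \<open>x = y\<close>, \<open>\<alpha> = 1\<close>), so the least one exists.\<close>

definition curvature_const ::
  "('a::real_normed_vector \<Rightarrow> real) \<Rightarrow> ('a \<Rightarrow> 'a \<Rightarrow>\<^sub>L real) \<Rightarrow> 'a set \<Rightarrow> real" where
  "curvature_const h grad Q = (LEAST C. curvature_bound h grad Q C)"

text \<open>A run of the Frank-Wolfe method for maximizing \<open>h\<close> over \<open>Q\<close> with step sizes \<open>a\<close>.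
  Iterates \<open>lam\<close>, linear maximizers \<open>lamt\<close>, gaps \<open>G\<close>, step sizes and the optional bounds \<open>Bo\<close> are
  indexed from 1 (their values at 0 are irrelevant), the upper bounds \<open>B\<close> from 0.
  Bounds are extended reals: \<open>B 0 = \<infinity>\<close> means that no initial bound is available, and
  \<open>Bo k = \<infinity>\<close> that no optional bound is computed at iteration \<open>k\<close>.\<close>

definition frank_wolfe_run ::
  "('a::real_normed_vector \<Rightarrow> real) \<Rightarrow> ('a \<Rightarrow> 'a \<Rightarrow>\<^sub>L real) \<Rightarrow> 'a set \<Rightarrow> (nat \<Rightarrow> real) \<Rightarrow>
   (nat \<Rightarrow> ereal) \<Rightarrow> (nat \<Rightarrow> 'a) \<Rightarrow> (nat \<Rightarrow> 'a) \<Rightarrow> (nat \<Rightarrow> ereal) \<Rightarrow> (nat \<Rightarrow> real) \<Rightarrow> bool" where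
  "frank_wolfe_run h grad Q a Bo lam lamt B G \<longleftrightarrow>
     lam 1 \<in> Q \<and>
     B 0 \<ge> ereal (max_value h Q) \<and>
     (\<forall>k\<ge>1.
        is_arg_max (\<lambda>x. h (lam k) + blinfun_apply (grad (lam k)) (x - lam k)) (\<lambda>x. x \<in> Q) (lamt k) \<and>
        G k = blinfun_apply (grad (lam k)) (lamt k - lam k) \<and>
        Bo k \<ge> ereal (max_value h Q) \<and>
        B k = min (min (B (k - 1))
                       (ereal (h (lam k) + blinfun_apply (grad (lam k)) (lamt k - lam k))))
                  (Bo k) \<and>
        a k \<in> {0..<1} \<and>
        lam (k + 1) = lam k + a k *\<^sub>R (lamt k - lam k))"

definition da_beta :: "(nat \<Rightarrow> real) \<Rightarrow> nat \<Rightarrow> real" where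
  "da_beta a k = 1 / (\<Prod>j\<in>{1..<k}. 1 - a j)"

definition da_alpha :: "(nat \<Rightarrow> real) \<Rightarrow> nat \<Rightarrow> real" where
  "da_alpha a k = da_beta a k * a k / (1 - a k)"

end

theory Submission
  imports Defs
begin

text \<open>
  The curvature inequality makes one step gain at least
  \<open>a i * G i - C / 2 * (a i)\<^sup>2\<close>. Summed over \<open>i = l+1, \<dots>, k\<close> it bounds a weighted average of the gaps
  by \<open>h (lam (k + 1)) - h (lam (l + 1))\<close>, and concavity yields \<open>h (lam (k + 1)) \<le> B l\<close>. Over
  \<open>i = 1, \<dots>, l\<close> one has \<open>h (lam i) + G i \<ge> B l\<close>, so that \<open>B l - h (lam i)\<close> contracts by the factor
  \<open>1 - a i\<close> up to the error \<open>C / 2 * (a i)\<^sup>2\<close>; multiplying by \<open>da_beta a (i + 1)\<close> makes this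
  recursion telescope.
\<close>

text \<open>\<open>LEAST\<close> on the reals carries information only when the minimum is attained.
  Each constraint is affine in \<open>C\<close>, so the admissible set is an intersection of closed
  sets and contains its infimum.\<close>

lemma curvature_bound_const:
  fixes h :: "'a::real_normed_vector \<Rightarrow> real"
  assumes "Q \<noteq> {}" and "finite_curvature h grad Q"
  shows "curvature_bound h grad Q (curvature_const h grad Q)"
proof -
  let ?S = "{C. curvature_bound h grad Q C}"
  have "?S = (\<Inter>x\<in>Q. \<Inter>y\<in>Q. \<Inter>\<alpha>\<in>{0..1}. {C. h x + blinfun_apply (grad x) (\<alpha> *\<^sub>R (y - x)) - 1 / 2 * C * \<alpha>\<^sup>2
      \<le> h (x + \<alpha> *\<^sub>R (y - x))})"
    by (auto simp: curvature_bound_def)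
  also have "closed \<dots>"
    by (intro closed_INT ballI closed_Collect_le continuous_intros)
  finally have "closed ?S" .
  moreover have "bdd_below ?S"
  proof (rule bdd_belowI)
    fix C assume "C \<in> ?S"
    moreover obtain x where "x \<in> Q" using \<open>Q \<noteq> {}\<close> by blast
    ultimately have "\<forall>\<alpha>\<in>{0..1}. 0 \<le> C * \<alpha>\<^sup>2"
      by (force simp: curvature_bound_def blinfun.zero_right)
    from bspec[OF this, of 1] show "0 \<le> C" by simp
  qed
  moreover have "?S \<noteq> {}" using assms(2) by (auto simp: finite_curvature_def)
  ultimately have "Inf ?S \<in> ?S" by (intro closed_contains_Inf)
  moreover have "curvature_const h grad Q = Inf ?S"
    unfolding curvature_const_def
    using \<open>Inf ?S \<in> ?S\<close> \<open>bdd_below ?S\<close> by (intro Least_equality) (auto intro: cInf_lower)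
  ultimately show ?thesis by simp
qed

lemma max_value_attained:
  fixes h :: "'a::topological_space \<Rightarrow> real"
  assumes "compact Q" "Q \<noteq> {}" "continuous_on Q h"
  obtains x where "x \<in> Q" "max_value h Q = h x" "\<And>y. y \<in> Q \<Longrightarrow> h y \<le> h x"
proof -
  obtain x where x: "x \<in> Q" "\<And>y. y \<in> Q \<Longrightarrow> h y \<le> h x"
    using continuous_attains_sup[OF assms] by blast
  have "max_value h Q = h x"
    unfolding max_value_def using x by (intro Greatest_equality) auto
  with x that show thesis by blast
qed

text \<open>Concavity bounds every difference quotient of \<open>h\<close> along the segment from
  \<open>x\<close> to \<open>y\<close> below by \<open>h y - h x\<close>; as the parameter tends to
  0 the quotients tend to \<open>D (y - x)\<close>.\<close>

lemma concave_on_below_tangent: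
  fixes h :: "'a::real_normed_vector \<Rightarrow> real"
  assumes conc: "concave_on Q h" and Q: "x \<in> Q" "y \<in> Q"
    and D: "(h has_derivative D) (at x within Q)"
  shows "h y \<le> h x + D (y - x)"
proof -
  let ?p = "\<lambda>t. x + t *\<^sub>R (y - x)"
  have "convex Q" using conc by (simp add: concave_on_def convex_on_def)
  have eq: "?p t = (1 - t) *\<^sub>R x + t *\<^sub>R y" for t by (simp add: algebra_simps)
  have sub: "?p ` {0..1} \<subseteq> Q"
    unfolding eq using \<open>convex Q\<close> Q by (auto intro!: convexD)
  interpret D: bounded_linear D using D by (rule has_derivative_bounded_linear)
  have "(?p has_derivative (\<lambda>t. t *\<^sub>R (y - x))) (at 0 within {0..1})"
    by (auto intro!: derivative_eq_intros)
  \<comment> \<open>The derivative is relative to \<open>Q\<close> only, so the chain rule is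
    applied within the image of the segment, which \<open>sub\<close> places inside
    \<open>Q\<close>.\<close>
  moreover have "(h has_derivative D) (at (?p 0) within ?p ` {0..1})"
    using has_derivative_subset[OF D sub] by simp
  ultimately have "((\<lambda>t. h (?p t)) has_derivative (\<lambda>t. D (t *\<^sub>R (y - x)))) (at 0 within {0..1})"
    by (rule has_derivative_in_compose)
  then have "((\<lambda>t. h (?p t)) has_real_derivative D (y - x)) (at 0 within {0..1})"
    by (simp add: has_field_derivative_def D.scaleR mult_commute_abs)
  then have "((\<lambda>t. (h (?p t) - h x) / t) \<longlongrightarrow> D (y - x)) (at 0 within {0..1})"
    by (simp add: has_field_derivative_iff)
  moreover have "\<forall>\<^sub>F t in at 0 within {0..1}. h y - h x \<le> (h (?p t) - h x) / t"
    unfolding eventually_at_filter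
  proof (intro always_eventually allI impI)
    fix t :: real assume t: "t \<noteq> 0" "t \<in> {0..1}"
    then have "(1 - t) * h x + t * h y \<le> h (?p t)"
      unfolding eq using Q by (intro concave_onD[OF conc]) auto
    with t show "h y - h x \<le> (h (?p t) - h x) / t" by (simp add: field_simps)
  qed
  moreover have "at 0 within {0..1} \<noteq> (bot :: real filter)"
    by (simp add: at_within_Icc_at_right)
  ultimately have "h y - h x \<le> D (y - x)" by (rule tendsto_lowerbound)
  then show ?thesis by simp
qed

lemma da_beta_pos:
  assumes "\<And>i. 1 \<le> i \<Longrightarrow> a i < 1"
  shows "0 < da_beta a k"
  unfolding da_beta_def using assms by (auto intro!: prod_pos)

lemma da_beta_Suc:
  assumes "1 \<le> k"
  shows "da_beta a (Suc k) = da_beta a k / (1 - a k)"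
  using assms by (simp add: da_beta_def prod.atLeastLessThan_Suc)

text \<open>Since \<open>da_alpha a k = da_beta a (Suc k) * a k\<close>, this turns a squared step
  error weighted by \<open>da_beta\<close> into a summand of the stated bound.\<close>

lemma da_alpha_square:
  assumes "1 \<le> k" and "0 < da_beta a (Suc k)"
  shows "(da_alpha a k)\<^sup>2 / da_beta a (Suc k) = da_beta a (Suc k) * (a k)\<^sup>2"
proof -
  have "da_alpha a k = da_beta a (Suc k) * a k"
    using assms(1) by (simp add: da_alpha_def da_beta_Suc)
  with assms(2) show ?thesis by (simp add: power2_eq_square)
qed

text \<open>\<open>da_beta\<close> is the integrating factor:
  \<open>da_beta a (Suc i) * (1 - a i) = da_beta a i\<close>, so the weighted quantities
  \<open>da_beta a i * d i\<close> grow only by the error terms.\<close>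

lemma dual_averages_recursion:
  fixes d :: "nat \<Rightarrow> real"
  assumes a: "\<And>i. 1 \<le> i \<Longrightarrow> a i < 1"
    and d: "\<And>i. 1 \<le> i \<Longrightarrow> i \<le> l \<Longrightarrow> d (Suc i) \<le> (1 - a i) * d i + c * (a i)\<^sup>2"
  shows "d (Suc l) \<le> d 1 / da_beta a (Suc l)
           + c * (\<Sum>i=1..l. (da_alpha a i)\<^sup>2 / da_beta a (Suc i)) / da_beta a (Suc l)"
proof -
  note pos = da_beta_pos[of a, OF a]
  have "da_beta a (Suc m) * d (Suc m)
      \<le> d 1 + c * (\<Sum>i=1..m. (da_alpha a i)\<^sup>2 / da_beta a (Suc i))" if "m \<le> l" for m
    using that
  proof (induction m)
    case 0
    \<comment> \<open>The empty product gives \<open>da_beta a 1 = 1\<close>.\<close>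
    then show ?case by (simp add: da_beta_def)
  next
    case (Suc m)
    let ?b = "da_beta a (Suc (Suc m))"
    have b: "?b * (1 - a (Suc m)) = da_beta a (Suc m)"
      using a[of "Suc m"] by (simp add: da_beta_Suc)
    have "?b * d (Suc (Suc m)) \<le> ?b * ((1 - a (Suc m)) * d (Suc m) + c * (a (Suc m))\<^sup>2)"
      using d[of "Suc m"] Suc.prems pos[of "Suc (Suc m)"] by (intro mult_left_mono) auto
    also have "\<dots> = (?b * (1 - a (Suc m))) * d (Suc m) + c * (?b * (a (Suc m))\<^sup>2)"
      by (simp add: algebra_simps)
    also have "\<dots> = da_beta a (Suc m) * d (Suc m) + c * ((da_alpha a (Suc m))\<^sup>2 / ?b)"
      using pos by (simp only: b da_alpha_square)
    also have "\<dots> \<le> d 1 + c * (\<Sum>i=1..m. (da_alpha a i)\<^sup>2 / da_beta a (Suc i))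
        + c * ((da_alpha a (Suc m))\<^sup>2 / ?b)"
      using Suc by simp
    also have "\<dots> = d 1 + c * (\<Sum>i=1..Suc m. (da_alpha a i)\<^sup>2 / da_beta a (Suc i))"
      by (simp add: distrib_left)
    finally show ?case .
  qed
  from this[of l] pos[of "Suc l"] show ?thesis by (simp add: field_simps)
qed

lemma weighted_average_ge_Min:
  fixes G w :: "'b \<Rightarrow> real"
  assumes "finite I" and "\<And>i. i \<in> I \<Longrightarrow> 0 \<le> w i"
  shows "Min (G ` I) * sum w I \<le> (\<Sum>i\<in>I. w i * G i)"
proof -
  have "Min (G ` I) * sum w I = (\<Sum>i\<in>I. w i * Min (G ` I))"
    by (simp add: sum_distrib_right mult.commute)
  also have "\<dots> \<le> (\<Sum>i\<in>I. w i * G i)"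
    using assms by (intro sum_mono mult_left_mono) auto
  finally show ?thesis .
qed

theorem theorem2p2:
  fixes Q :: "'a::real_normed_vector set"
    and h :: "'a \<Rightarrow> real"
    and grad :: "'a \<Rightarrow> 'a \<Rightarrow>\<^sub>L real"
    and a :: "nat \<Rightarrow> real"
    and lam lamt :: "nat \<Rightarrow> 'a"
    and B Bo :: "nat \<Rightarrow> ereal"
    and G :: "nat \<Rightarrow> real"
    and l k :: nat
  assumes finite_dim: "\<exists>S :: 'a set. finite S \<and> span S = UNIV"
    and Q: "Q \<noteq> {}" "convex Q" "compact Q"
    and concave: "concave_on Q h"
    and gradient: "\<And>x. x \<in> Q \<Longrightarrow> (h has_derivative blinfun_apply (grad x)) (at x within Q)"
    and curvature: "finite_curvature h grad Q"
    and run: "frank_wolfe_run h grad Q a Bo lam lamt B G"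
    and k: "k \<ge> l + 1"
    and pos: "(\<Sum>i=l+1..k. a i) > 0"
  shows "ereal (Min (G ` {l+1..k})) \<le>
           ereal (1 / (\<Sum>i=l+1..k. a i)) *
             ((B l - ereal (h (lam 1))) / ereal (da_beta a (l + 1)) +
              ereal ((1 / 2 * curvature_const h grad Q *
                        (\<Sum>i=1..l. (da_alpha a i)\<^sup>2 / da_beta a (i + 1))) / da_beta a (l + 1))) +
           ereal ((1 / 2 * curvature_const h grad Q * (\<Sum>i=l+1..k. (a i)\<^sup>2)) /
                    (\<Sum>i=l+1..k. a i))"
proof -
  let ?C = "curvature_const h grad Q"
  let ?A = "\<Sum>i=l+1..k. a i"
  let ?S = "\<Sum>i=1..l. (da_alpha a i)\<^sup>2 / da_beta a (i + 1)"
  have lam1: "lam 1 \<in> Q" and B0: "B 0 \<ge> ereal (max_value h Q)"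
    using run by (auto simp: frank_wolfe_run_def)
  have lamt: "lamt i \<in> Q"
    and lamt_max: "y \<in> Q \<Longrightarrow>
      blinfun_apply (grad (lam i)) (y - lam i) \<le> blinfun_apply (grad (lam i)) (lamt i - lam i)"
    and G: "G i = blinfun_apply (grad (lam i)) (lamt i - lam i)"
    and Bo: "Bo i \<ge> ereal (max_value h Q)"
    and B: "B i = min (min (B (i - 1)) (ereal (h (lam i) + G i))) (Bo i)"
    and a: "0 \<le> a i" "a i < 1"
    and step: "lam (Suc i) = lam i + a i *\<^sub>R (lamt i - lam i)" if "1 \<le> i" for i y
    using run that by (auto simp: frank_wolfe_run_def is_arg_max_linorder)
  have a_lt: "\<And>i. 1 \<le> i \<Longrightarrow> a i < 1" using a by blast
  have lam: "lam i \<in> Q" if "1 \<le> i" for i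
    using that
  proof (induction i rule: dec_induct)
    case base
    show ?case by (fact lam1)
  next
    case (step i)
    have "(1 - a i) *\<^sub>R lam i + a i *\<^sub>R lamt i \<in> Q"
      using step a lamt Q(2) by (intro convexD) (auto simp: less_imp_le)
    moreover have "lam (Suc i) = (1 - a i) *\<^sub>R lam i + a i *\<^sub>R lamt i"
      using run step(1) by (simp add: frank_wolfe_run_def algebra_simps)
    ultimately show ?case by simp
  qed
  have "continuous_on Q h"
    using gradient by (meson continuous_on_eq_continuous_within has_derivative_continuous)
  then obtain z where z: "z \<in> Q" "max_value h Q = h z" "\<And>y. y \<in> Q \<Longrightarrow> h y \<le> h z"
    using max_value_attained Q by blast
  have B_ge: "ereal (h z) \<le> B i" for i
  proof (induction i)
    case 0
    then show ?case using B0 z by simp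
  next
    case (Suc i)
    \<comment> \<open>The tangent at the iterate lies above \<open>h\<close> at \<open>z\<close>,
      and over \<open>Q\<close> the linear model is largest at \<open>lamt (Suc i)\<close>.\<close>
    have "h z \<le> h (lam (Suc i)) + G (Suc i)"
      using concave_on_below_tangent[OF concave lam[of "Suc i"] z(1) gradient] lam[of "Suc i"]
        lamt_max[of "Suc i" z] z(1) by (simp add: G)
    with Suc Bo[of "Suc i"] z(2) show ?case by (simp add: B[of "Suc i"])
  qed
  \<comment> \<open>The curvature inequality with \<open>x = lam i\<close>,
    \<open>y = lamt i\<close> and \<alpha> equal to the step size.\<close>
  have gain: "h (lam (Suc i)) \<ge> h (lam i) + a i * G i - 1 / 2 * ?C * (a i)\<^sup>2" if "1 \<le> i" for i
  proof -
    have "a i \<in> {0..1}" using a[OF that] by simp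
    then show ?thesis
      using curvature_bound_const[OF Q(1) curvature] lam[OF that] lamt[OF that]
      by (force simp: curvature_bound_def step[OF that] G[OF that] blinfun.scaleR_right)
  qed
  show ?thesis
  proof (cases "B l = \<infinity>")
    case True
    \<comment> \<open>All other terms on the right are real, so the whole right-hand side is
      infinite. This occurs only for \<open>l = 0\<close>: later bounds are at most a real Wolfe
      bound.\<close>
    have "(B l - ereal (h (lam 1))) / ereal (da_beta a (l + 1)) = \<infinity>"
      using True da_beta_pos[of a, OF a_lt] by (simp add: divide_ereal_def)
    with pos show ?thesis by simp
  next
    case False
    then obtain b where b: "B l = ereal b"
      using B_ge[of l] by (cases "B l") auto
    \<comment> \<open>Monotonicity lets the single number \<open>b\<close> serve in the recursion at
      every \<open>i \<le> l\<close>.\<close>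
    have antimono: "B m \<le> B i" if "i \<le> m" for i m
      using that
    proof (induction m rule: dec_induct)
      case (step m)
      then show ?case using B[of "Suc m"] by (auto simp: min_le_iff_disj)
    qed simp
    have Bw: "b \<le> h (lam i) + G i" if "1 \<le> i" "i \<le> l" for i
    proof -
      have "ereal b \<le> B i" using antimono[OF that(2)] b by simp
      also have "\<dots> \<le> ereal (h (lam i) + G i)" by (simp add: B[OF that(1)] min_le_iff_disj)
      finally show ?thesis by simp
    qed
    \<comment> \<open>Here \<open>Bw\<close> is read as \<open>G i \<ge> b - h (lam i)\<close> and
      inserted into \<open>gain\<close>.\<close>
    have "b - h (lam (Suc i)) \<le> (1 - a i) * (b - h (lam i)) + 1 / 2 * ?C * (a i)\<^sup>2"
      if "1 \<le> i" "i \<le> l" for i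
    proof -
      have "a i * (b - h (lam i)) \<le> a i * G i"
        using Bw[OF that] a[OF that(1)] by (intro mult_left_mono) auto
      with gain[OF that(1)] show ?thesis by (simp add: algebra_simps)
    qed
    then have first: "b - h (lam (l + 1)) \<le>
        (b - h (lam 1)) / da_beta a (l + 1) + 1 / 2 * ?C * ?S / da_beta a (l + 1)"
      using dual_averages_recursion[of a l "\<lambda>i. b - h (lam i)" "1 / 2 * ?C", OF a_lt] by simp
    have "Min (G ` {l+1..k}) * ?A \<le> (\<Sum>i=l+1..k. a i * G i)"
      by (rule weighted_average_ge_Min) (auto simp: a)
    \<comment> \<open>Solving \<open>gain\<close> for \<open>a i * G i\<close> makes the values of
      \<open>h\<close> telescope.\<close>
    also have "\<dots> \<le> (\<Sum>i=l+1..k. (h (lam (Suc i)) - h (lam i)) + 1 / 2 * ?C * (a i)\<^sup>2)"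
    proof (rule sum_mono)
      fix i assume "i \<in> {l+1..k}"
      then show "a i * G i \<le> (h (lam (Suc i)) - h (lam i)) + 1 / 2 * ?C * (a i)\<^sup>2"
        using gain[of i] by simp
    qed
    also have "\<dots> = (h (lam (Suc k)) - h (lam (l + 1))) + 1 / 2 * ?C * (\<Sum>i=l+1..k. (a i)\<^sup>2)"
      using k sum_Suc_diff[of "l + 1" k "\<lambda>i. h (lam i)"] by (simp add: sum.distrib sum_distrib_left)
    \<comment> \<open>Although \<open>b\<close> dates from iteration \<open>l\<close>, it bounds the
      maximum over \<open>Q\<close> and hence later iterates too. What remains is
      \<open>b - h (lam (l + 1))\<close>, controlled by \<open>first\<close>.\<close>
    also have "h (lam (Suc k)) \<le> b"
      using z(3)[OF lam[of "Suc k"]] B_ge[of l] b by simp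
    finally have "Min (G ` {l+1..k}) * ?A \<le>
        ((b - h (lam 1)) / da_beta a (l + 1) + 1 / 2 * ?C * ?S / da_beta a (l + 1))
        + 1 / 2 * ?C * (\<Sum>i=l+1..k. (a i)\<^sup>2)"
      using first by simp
    then have "Min (G ` {l+1..k}) \<le>
        (((b - h (lam 1)) / da_beta a (l + 1) + 1 / 2 * ?C * ?S / da_beta a (l + 1))
        + 1 / 2 * ?C * (\<Sum>i=l+1..k. (a i)\<^sup>2)) / ?A"
      using pos by (simp only: pos_le_divide_eq)
    also have "\<dots> = 1 / ?A *
        ((b - h (lam 1)) / da_beta a (l + 1) + 1 / 2 * ?C * ?S / da_beta a (l + 1))
        + 1 / 2 * ?C * (\<Sum>i=l+1..k. (a i)\<^sup>2) / ?A"
      by (simp only: add_divide_distrib times_divide_eq_left mult_1_left)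
    finally show ?thesis
      using da_beta_pos[of a "l + 1", OF a_lt] by (simp add: b)
  qed
qed

end
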